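(* Let $q\ge 1$ be an integer and let $z\in\mathbb{C}$. The generating function of the generalized ordinary multinomials is given by $$\sum_{n\ge 0}\binom{z}{n}_q t^n=\left(1+t+t^2+\cdots+t^q\right)^{z},$$ as an identity of formal power series in $t$.
   Context: For $z\in\mathbb{C}$ and integers $q\ge1$, $k\ge 0$, the generalized ordinary multinomial is $$\binom{z}{k}_q:=\sum_{k_1+k_2+\cdots+k_q=k}\frac{z(z-1)\cdots(z-k_1+1)}{(k_1-k_2)!\,(k_2-k_3)!\cdots(k_{q-1}-k_q)!\,k_q!},$$ the sum running over nonnegative integers $k_1,\ldots,k_q$ with sum $k$, where a term is $0$ as soon as some $k_i<k_{i+1}$ (reciprocal of the factorial of a negative integer is $0$), and the numerator is $1$ when $k_1=0$. For complex $z$, the power is the formal power series $(1+t+\cdots+t^q)^z=\sum_{m\ge0}\frac{z(z-1)\cdots(z-m+1)}{m!}(t+t^2+\cdots+t^q)^m$. *)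

theory Defs
  imports Complex_Main "HOL-Library.FuncSet" "HOL-Computational_Algebra.Formal_Power_Series"
begin

text \<open>Reciprocal factorial on the integers, with the convention that the reciprocal of the
  factorial of a negative integer is 0.\<close>

definition rfact :: "int \<Rightarrow> complex" where
  "rfact m = (if m < 0 then 0 else 1 / fact (nat m))"

text \<open>The tuples \<open>(k\<^sub>1, \<dots>, k\<^sub>q)\<close> of natural numbers with sum \<open>n\<close>, as functions that are
  \<open>undefined\<close> outside of \<open>{1..q}\<close>, so that every tuple is represented exactly once.\<close>

definition sum_tuples :: "nat \<Rightarrow> nat \<Rightarrow> (nat \<Rightarrow> nat) set" where
  "sum_tuples q n = {k \<in> {1..q} \<rightarrow>\<^sub>E UNIV. (\<Sum>i=1..q. k i) = n}"

lemma finite_sum_tuples: "finite (sum_tuples q n)"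
proof (rule finite_subset)
  show "sum_tuples q n \<subseteq> {1..q} \<rightarrow>\<^sub>E {..n}"
  proof
    fix k assume k: "k \<in> sum_tuples q n"
    have "k i \<le> n" if "i \<in> {1..q}" for i
      using member_le_sum[of i "{1..q}" k] that k by (simp add: sum_tuples_def)
    then show "k \<in> {1..q} \<rightarrow>\<^sub>E {..n}"
      using k by (auto simp: sum_tuples_def PiE_iff)
  qed
qed (simp add: finite_PiE)

text \<open>Only meant for \<open>q \<ge> 1\<close>.\<close>

definition gen_multinomial :: "nat \<Rightarrow> complex \<Rightarrow> nat \<Rightarrow> complex" where
  "gen_multinomial q z n =
     (\<Sum>k\<in>sum_tuples q n.
        (\<Prod>j<k 1. z - of_nat j) *
        (\<Prod>i\<in>{1..<q}. rfact (int (k i) - int (k (i + 1)))) * rfact (int (k q)))"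

text \<open>The complex power of a formal power series with constant term 1, as the binomial series in
  \<open>f - 1\<close>. The infinite sum is taken in the topology of the formal power series; it converges by
  the lemmas below.\<close>

definition fps_cpower :: "complex fps \<Rightarrow> complex \<Rightarrow> complex fps" where
  "fps_cpower f z = (\<Sum>m. fps_const (z gchoose m) * (f - 1) ^ m)"

lemma fps_cpower_sums_compose:
  assumes "fps_nth f 0 = 1"
  shows "(\<lambda>m. fps_const (z gchoose m) * (f - 1) ^ m) sums fps_compose (fps_binomial z) (f - 1)"
  unfolding sums_def
proof (rule tendsto_fpsI)
  fix n
  have z: "fps_nth ((f - 1) ^ m) n = 0" if "m > n" for m
    using startsby_zero_power_prefix[of "f - 1" m] assms that by simp
  have "fps_nth (\<Sum>m<N. fps_const (z gchoose m) * (f - 1) ^ m) n =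
      fps_nth (fps_compose (fps_binomial z) (f - 1)) n" if "N > n" for N
  proof -
    have "fps_nth (\<Sum>m<N. fps_const (z gchoose m) * (f - 1) ^ m) n =
        (\<Sum>m<N. (z gchoose m) * fps_nth ((f - 1) ^ m) n)"
      by (simp add: fps_sum_nth)
    also have "\<dots> = (\<Sum>m=0..n. (z gchoose m) * fps_nth ((f - 1) ^ m) n)"
      using that z by (intro sum.mono_neutral_right) auto
    finally show ?thesis
      by (simp add: fps_compose_nth)
  qed
  then show "\<forall>\<^sub>F N in sequentially. fps_nth (\<Sum>m<N. fps_const (z gchoose m) * (f - 1) ^ m) n =
      fps_nth (fps_compose (fps_binomial z) (f - 1)) n"
    by (auto simp: eventually_at_top_dense)
qed

lemma fps_cpower_sums:
  assumes "fps_nth f 0 = 1"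
  shows "(\<lambda>m. fps_const (z gchoose m) * (f - 1) ^ m) sums fps_cpower f z"
  unfolding fps_cpower_def
  using fps_cpower_sums_compose[OF assms] by (rule summable_sums[OF sums_summable])

end

theory Submission
  imports Defs
begin

text \<open>Expanding \<open>(t + \<dots> + t\<^sup>q)\<^sup>m = t\<^sup>m (1 + (t + \<dots> + t\<^bsup>q-1\<^esup>))\<^sup>m\<close> by the binomial theorem, and then
  each power of \<open>t + \<dots> + t\<^bsup>q-1\<^esup>\<close> in the same way, gives a sum over \<open>m = k\<^sub>1 \<ge> k\<^sub>2 \<ge> \<dots> \<ge> k\<^sub>q\<close> in which
  the binomial coefficients telescope to \<open>k\<^sub>1! / ((k\<^sub>1 - k\<^sub>2)! \<dots> (k\<^bsub>q-1\<^esub> - k\<^sub>q)! k\<^sub>q!)\<close>. The factor \<open>m!\<close>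
  cancels against the denominator of the \<open>m\<close>-th binomial coefficient of \<open>z\<close>.\<close>

text \<open>The tuples are indexed by \<open>{a..q}\<close> rather than by \<open>{1..q}\<close>, so that the induction over the
  number of entries can remove the head \<open>k\<^sub>a\<close> without shifting indices.\<close>

definition head_tuples :: "nat \<Rightarrow> nat \<Rightarrow> nat \<Rightarrow> nat \<Rightarrow> (nat \<Rightarrow> nat) set" where
  "head_tuples a q m n = {k \<in> {a..q} \<rightarrow>\<^sub>E UNIV. (\<Sum>i=a..q. k i) = n \<and> k a = m}"

text \<open>For \<open>a \<le> q\<close>, \<open>fact (k a)\<close> times this weight is the product
  of the \<open>k i choose k (i + 1)\<close> over \<open>a \<le> i < q\<close>; both vanish if some
  entry increases.\<close>

definition chain_weight :: "nat \<Rightarrow> nat \<Rightarrow> (nat \<Rightarrow> nat) \<Rightarrow> complex" where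
  "chain_weight a q k =
     (\<Prod>i\<in>{a..<q}. rfact (int (k i) - int (k (i + 1)))) * rfact (int (k q))"

lemma finite_PiE_sum_eq:
  fixes n :: nat
  assumes "finite I"
  shows "finite {k \<in> I \<rightarrow>\<^sub>E UNIV. sum k I = n}"
proof (rule finite_subset)
  show "{k \<in> I \<rightarrow>\<^sub>E UNIV. sum k I = n} \<subseteq> I \<rightarrow>\<^sub>E {..n}"
    using assms member_le_sum[of _ I] by (fastforce simp: PiE_iff)
qed (simp add: assms finite_PiE)

lemma rfact_of_nat [simp]: "rfact (int n) = 1 / fact n"
  by (simp add: rfact_def)

lemma fact_mult_rfact_diff:
  assumes "j \<le> m"
  shows "fact m * rfact (int m - int j) = of_nat (m choose j) * fact j"
  using assms by (simp add: rfact_def nat_diff_distrib' binomial_fact)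

lemma head_tuples_singleton:
  "head_tuples q q m n = (if n = m then {\<lambda>i. if i = q then m else undefined} else {})"
  by (auto simp: head_tuples_def PiE_iff extensional_def)

text \<open>Deleting the head \<open>m\<close> leaves a tuple with sum \<open>n - m\<close>; these
  are grouped by their own head \<open>j\<close>. This mirrors one binomial expansion of the power
  series.\<close>

lemma sum_head_tuples_Suc:
  fixes n :: nat
  assumes "a < q"
  shows "(\<Sum>k\<in>head_tuples a q m n. chain_weight a q k) =
    (if m \<le> n then \<Sum>j\<le>m. rfact (int m - int j) *
       (\<Sum>k\<in>head_tuples (Suc a) q j (n - m). chain_weight (Suc a) q k) else 0)"
proof (cases "m \<le> n")
  case True
  define T where "T = {k \<in> {Suc a..q} \<rightarrow>\<^sub>E UNIV. (\<Sum>i=Suc a..q. k i) = n - m}"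
  have fin: "finite T"
    unfolding T_def by (rule finite_PiE_sum_eq) simp
  have split: "(\<Sum>i=a..q. k i) = k a + (\<Sum>i=Suc a..q. k i)" for k :: "nat \<Rightarrow> nat"
    using assms by (simp add: sum.atLeast_Suc_atMost)
  have weight: "chain_weight a q (k(a := m)) =
      rfact (int m - int (k (Suc a))) * chain_weight (Suc a) q k" for k
  proof -
    have "(\<Prod>i\<in>{Suc a..<q}. rfact (int ((k(a := m)) i) - int ((k(a := m)) (i + 1)))) =
        (\<Prod>i\<in>{Suc a..<q}. rfact (int (k i) - int (k (i + 1))))"
      by (rule prod.cong) auto
    then show ?thesis
      using assms by (simp add: chain_weight_def prod.atLeast_Suc_lessThan)
  qed
  have "(\<Sum>k\<in>head_tuples a q m n. chain_weight a q k) =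
      (\<Sum>k\<in>T. rfact (int m - int (k (Suc a))) * chain_weight (Suc a) q k)"
  \<comment> \<open>Resetting position \<open>a\<close> to \<open>undefined\<close> makes the tail
    extensional on \<open>{Suc a..q}\<close>.\<close>
  proof (rule sum.reindex_bij_witness[where i = "\<lambda>k. k(a := m)" and j = "\<lambda>k. k(a := undefined)"])
    fix k assume k: "k \<in> head_tuples a q m n"
    show eq: "(k(a := undefined))(a := m) = k"
      using k by (auto simp: head_tuples_def)
    have "(\<Sum>i=Suc a..q. (k(a := undefined)) i) = (\<Sum>i=Suc a..q. k i)"
      by (rule sum.cong) auto
    then show "k(a := undefined) \<in> T"
      using k split[of k] by (auto simp: T_def head_tuples_def PiE_iff extensional_def)
    show "rfact (int m - int ((k(a := undefined)) (Suc a))) *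
        chain_weight (Suc a) q (k(a := undefined)) = chain_weight a q k"
      using weight[of "k(a := undefined)"] eq by simp
  next
    fix k assume k: "k \<in> T"
    show "(k(a := m))(a := undefined) = k"
      using k by (auto simp: T_def PiE_iff extensional_def)
    have "(\<Sum>i=Suc a..q. (k(a := m)) i) = (\<Sum>i=Suc a..q. k i)"
      by (rule sum.cong) auto
    then show "k(a := m) \<in> head_tuples a q m n"
      using k split[of "k(a := m)"] assms True
      by (auto simp: T_def head_tuples_def PiE_iff extensional_def)
  qed
  \<comment> \<open>A next entry above \<open>m\<close> gives the reciprocal factorial of a negative
    integer, which is 0.\<close>
  also have "\<dots> = (\<Sum>k\<in>{k \<in> T. k (Suc a) \<le> m}.
      rfact (int m - int (k (Suc a))) * chain_weight (Suc a) q k)"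
    by (rule sum.mono_neutral_right) (use fin in \<open>auto simp: rfact_def\<close>)
  also have "\<dots> = (\<Sum>j\<le>m. \<Sum>k\<in>{k \<in> {k \<in> T. k (Suc a) \<le> m}. k (Suc a) = j}.
      rfact (int m - int (k (Suc a))) * chain_weight (Suc a) q k)"
    by (rule sum.group[symmetric]) (use fin in auto)
  also have "\<dots> = (\<Sum>j\<le>m. rfact (int m - int j) *
      (\<Sum>k\<in>head_tuples (Suc a) q j (n - m). chain_weight (Suc a) q k))"
    unfolding sum_distrib_left
    by (intro sum.cong refl) (auto simp: T_def head_tuples_def)
  finally show ?thesis
    using True by simp
next
  case False
  then have "head_tuples a q m n = {}"
    using assms by (auto simp: head_tuples_def sum.atLeast_Suc_atMost)
  with False show ?thesis
    by simp
qed

text \<open>Downward induction from \<open>a = q\<close>, where the base is just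
  \<open>fps_X\<close>. The top exponent \<open>Suc q - a\<close> is the number of entries in a
  tuple, so factoring out \<open>fps_X\<close> lowers both by one.\<close>

lemma fps_nth_power_sum_X_powers:
  assumes "a \<le> q"
  shows "fps_nth ((\<Sum>i=1..Suc q - a. fps_X ^ i) ^ m) n =
    fact m * (\<Sum>k\<in>head_tuples a q m n. chain_weight a q k)"
  using assms
proof (induction a arbitrary: m n rule: inc_induct)
  case base
  then show ?case
    by (auto simp: head_tuples_singleton chain_weight_def)
next
  case (step a)
  define g :: "complex fps" where "g = (\<Sum>i=1..q - a. fps_X ^ i)"
  have "(\<Sum>i=1..Suc q - a. fps_X ^ i) = (\<Sum>i=0..q - a. fps_X ^ Suc i :: complex fps)"
    using step.hyps sum.shift_bounds_cl_Suc_ivl[of "\<lambda>i. fps_X ^ i" 0 "q - a"]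
    by (simp only: Suc_diff_le less_imp_le One_nat_def)
  also have "\<dots> = fps_X * (g + 1)"
    by (simp add: g_def sum_distrib_left sum.atLeast_Suc_atMost algebra_simps)
  finally have "(\<Sum>i=1..Suc q - a. fps_X ^ i) ^ m =
      fps_X ^ m * (\<Sum>j\<le>m. fps_const (of_nat (m choose j)) * g ^ j)"
    by (simp add: power_mult_distrib binomial_ring[of g 1] fps_of_nat)
  then have "fps_nth ((\<Sum>i=1..Suc q - a. fps_X ^ i) ^ m) n =
      (if m \<le> n then \<Sum>j\<le>m. of_nat (m choose j) * fps_nth (g ^ j) (n - m) else 0)"
    by (simp add: fps_X_power_mult_nth fps_sum_nth)
  \<comment> \<open>The \<open>fact j\<close> from the induction hypothesis turns
    \<open>m choose j\<close> into \<open>fact m * rfact (int m - int j)\<close>.\<close>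
  also have "\<dots> = (if m \<le> n then \<Sum>j\<le>m. fact m * (rfact (int m - int j) *
       (\<Sum>k\<in>head_tuples (Suc a) q j (n - m). chain_weight (Suc a) q k)) else 0)"
    using step.IH
    by (auto intro!: sum.cong simp: g_def fact_mult_rfact_diff simp flip: mult.assoc)
  also have "\<dots> = fact m * (\<Sum>k\<in>head_tuples a q m n. chain_weight a q k)"
    using step.hyps by (simp add: sum_head_tuples_Suc sum_distrib_left)
  finally show ?case .
qed

text \<open>The falling factorial depends only on the first entry, which is at most
  \<open>n\<close>, so it factors out after grouping by that entry.\<close>

lemma gen_multinomial_eq_sum_head_tuples:
  assumes "q \<ge> 1"
  shows "gen_multinomial q z n =
    (\<Sum>m=0..n. (\<Prod>j<m. z - of_nat j) * (\<Sum>k\<in>head_tuples 1 q m n. chain_weight 1 q k))"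
proof -
  have "k 1 \<le> n" if "k \<in> sum_tuples q n" for k
    using that assms member_le_sum[of 1 "{1..q}" k] by (simp add: sum_tuples_def)
  then have "gen_multinomial q z n = (\<Sum>m=0..n. \<Sum>k\<in>{k \<in> sum_tuples q n. k 1 = m}.
      (\<Prod>j<k 1. z - of_nat j) * chain_weight 1 q k)"
    unfolding gen_multinomial_def chain_weight_def mult.assoc
    by (intro sum.group[symmetric] finite_sum_tuples) auto
  also have "\<dots> = (\<Sum>m=0..n. (\<Prod>j<m. z - of_nat j) *
      (\<Sum>k\<in>head_tuples 1 q m n. chain_weight 1 q k))"
    unfolding sum_distrib_left
    by (intro sum.cong refl) (auto simp: sum_tuples_def head_tuples_def)
  finally show ?thesis .
qed

theorem theorem8:
  fixes q :: nat and z :: complex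
  assumes "q \<ge> 1"
  shows "Abs_fps (\<lambda>n. gen_multinomial q z n) = fps_cpower (\<Sum>i=0..q. fps_X ^ i) z"
proof (rule fps_ext)
  fix n
  define f :: "complex fps" where "f = (\<Sum>i=0..q. fps_X ^ i)"
  \<comment> \<open>The form \<open>Suc q - 1\<close> matches the power lemma at
    \<open>a = 1\<close>.\<close>
  have f: "f - 1 = (\<Sum>i=1..Suc q - 1. fps_X ^ i)"
    by (simp add: f_def sum.atLeast_Suc_atMost)
  have "fps_nth f 0 = 1"
    by (simp add: f_def fps_sum_nth sum.delta')
  \<comment> \<open>Both sides are limits of the same series; composition makes each coefficient a
    finite sum.\<close>
  then have "fps_cpower f z = fps_compose (fps_binomial z) (f - 1)"
    using fps_cpower_sums fps_cpower_sums_compose sums_unique2 by blast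
  then have "fps_nth (fps_cpower f z) n = (\<Sum>m=0..n. (z gchoose m) * fps_nth ((f - 1) ^ m) n)"
    by (simp add: fps_compose_nth)
  also have "\<dots> = (\<Sum>m=0..n. (\<Prod>j<m. z - of_nat j) *
      (\<Sum>k\<in>head_tuples 1 q m n. chain_weight 1 q k))"
    unfolding f fps_nth_power_sum_X_powers[OF assms]
    by (simp add: gbinomial_prod_rev atLeast0LessThan)
  also have "\<dots> = gen_multinomial q z n"
    using assms by (rule gen_multinomial_eq_sum_head_tuples[symmetric])
  finally show "fps_nth (Abs_fps (\<lambda>n. gen_multinomial q z n)) n =
      fps_nth (fps_cpower (\<Sum>i=0..q. fps_X ^ i) z) n"
    by (simp add: f_def)
qed

end
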